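(* Let $\mathcal{K}(x,y)=\sum_{n\geq 0}\sum_{r=0}^{n}k(r,n)\frac{x^r y^{n-r}}{r!\,(n-r)!}$. Then \[\mathcal{K}(x,y)=\frac{\mathcal{L}(x,y)+1}{1-x-y+xy},\] where $\mathcal{L}(x,y)$ is the unique power series satisfying $\partial_x\partial_y\mathcal{L}(x,y)=e^{x+y}I_0(2\sqrt{xy})$ with boundary conditions $\mathcal{L}(x,0)=0$ and $\mathcal{L}(0,y)=0$.
   Context: Let $\mathfrak{S}_n$ be the group of permutations of $\{1,\dots,n\}$ in one-line notation. A permutation $w\in\mathfrak{S}_n$ contains the split pattern $3|12$ with respect to position $r$ if there are indices $i_1\leq r<i_2<i_3$ with $w(i_2)<w(i_3)<w(i_1)$; it contains $23|1$ with respect to position $r$ if there are indices $i_1<i_2\leq r<i_3$ with $w(i_3)<w(i_1)<w(i_2)$. Let $k(r,n)$ be the number of $w\in\mathfrak{S}_n$ avoiding both patterns with respect to position $r$, with $k(0,0)=1$. Here $I_0(z)=\sum_{m\geq 0}\frac{1}{(m!)^2}\left(\frac{z^2}{4}\right)^m$ is the modified Bessel function of the first kind of order $0$; note $I_0(2\sqrt{xy})=\sum_{m\ge0}\frac{(xy)^m}{(m!)^2}$ is a power series in $x,y$. Identities are as formal power series (equivalently, analytic functions near the origin). *)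

theory Defs
  imports Complex_Main "HOL-Computational_Algebra.Formal_Power_Series" "HOL-Combinatorics.Permutations"
begin

definition contains_3_12 :: "nat \<Rightarrow> nat \<Rightarrow> (nat \<Rightarrow> nat) \<Rightarrow> bool" where
  "contains_3_12 r n w \<longleftrightarrow>
     (\<exists>i1\<in>{1..n}. \<exists>i2\<in>{1..n}. \<exists>i3\<in>{1..n}.
        i1 \<le> r \<and> r < i2 \<and> i2 < i3 \<and> w i2 < w i3 \<and> w i3 < w i1)"

definition contains_23_1 :: "nat \<Rightarrow> nat \<Rightarrow> (nat \<Rightarrow> nat) \<Rightarrow> bool" where
  "contains_23_1 r n w \<longleftrightarrow>
     (\<exists>i1\<in>{1..n}. \<exists>i2\<in>{1..n}. \<exists>i3\<in>{1..n}.
        i1 < i2 \<and> i2 \<le> r \<and> r < i3 \<and> w i3 < w i1 \<and> w i1 < w i2)"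

definition kcount :: "nat \<Rightarrow> nat \<Rightarrow> nat" where
  "kcount r n = card {w. w permutes {1..n} \<and> \<not> contains_3_12 r n w \<and> \<not> contains_23_1 r n w}"

lemma kcount_0_0: "kcount 0 0 = 1"
  by (simp add: kcount_def contains_3_12_def contains_23_1_def)

unbundle fps_syntax

text \<open>
  A formal power series in \<open>x, y\<close> is a power series in \<open>x\<close> whose coefficients are power series
  in \<open>y\<close>: the coefficient of \<open>x\<^sup>i y\<^sup>j\<close> in \<open>F\<close> is \<open>F $ i $ j\<close>.
\<close>

type_synonym bfps = "real fps fps"

definition bX :: bfps where "bX = fps_X"

definition bY :: bfps where "bY = fps_const fps_X"

definition dx :: "bfps \<Rightarrow> bfps" where "dx F = fps_deriv F"

definition dy :: "bfps \<Rightarrow> bfps" where "dy F = Abs_fps (\<lambda>i. fps_deriv (F $ i))"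

definition at_x0 :: "bfps \<Rightarrow> real fps" where "at_x0 F = F $ 0"

definition at_y0 :: "bfps \<Rightarrow> real fps" where "at_y0 F = Abs_fps (\<lambda>i. F $ i $ 0)"

text \<open>
  The substitution \<open>f(G(x,y)) = \<Sum>m. f\<^sub>m G(x,y)^m\<close>, meaningful for \<open>G\<close> with zero constant
  term. Then \<open>G^m\<close> has no terms of total degree below \<open>m\<close>, so only \<open>m \<le> i + j\<close> contributes to
  the coefficient of \<open>x\<^sup>i y\<^sup>j\<close>.
\<close>

definition bsubst :: "real fps \<Rightarrow> bfps \<Rightarrow> bfps" where
  "bsubst f G = Abs_fps (\<lambda>i. Abs_fps (\<lambda>j. \<Sum>m\<le>i + j. f $ m * (G ^ m) $ i $ j))"

text \<open>
  \<open>I\<^sub>0(z)\<close> is a power series in \<open>t = z\<^sup>2/4\<close>, namely \<open>\<Sum>m. t^m / (m!)\<^sup>2\<close>. As \<open>z = 2 \<surd>(xy)\<close>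
  corresponds to \<open>t = xy\<close>, the series \<open>I\<^sub>0(2 \<surd>(xy))\<close> is obtained by substituting \<open>xy\<close> for \<open>t\<close>.
\<close>

definition I0_core :: "real fps" where
  "I0_core = Abs_fps (\<lambda>m. 1 / (fact m)\<^sup>2)"

definition bessel_I0 :: "real \<Rightarrow> real" where
  "bessel_I0 z = (\<Sum>m. 1 / (fact m)\<^sup>2 * (z\<^sup>2 / 4) ^ m)"

lemma bessel_I0_2sqrt:
  assumes "x * y \<ge> 0"
  shows "bessel_I0 (2 * sqrt (x * y)) = (\<Sum>m. I0_core $ m * (x * y) ^ m)"
  using assms by (simp add: bessel_I0_def I0_core_def power_mult_distrib)

definition I0_2sqrt_xy :: bfps where
  "I0_2sqrt_xy = bsubst I0_core (bX * bY)"

definition exp_x_plus_y :: bfps where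
  "exp_x_plus_y = bsubst (fps_exp 1) (bX + bY)"

lemma I0_2sqrt_xy_nth: "I0_2sqrt_xy $ i $ j = (if i = j then 1 / (fact i)\<^sup>2 else 0)"
proof -
  have "((bX * bY) ^ m) $ i $ j = (if i = m \<and> j = m then 1 else 0)" for m
    by (simp add: bX_def bY_def power_mult_distrib fps_const_power fps_X_power_nth)
  then have "I0_2sqrt_xy $ i $ j = (\<Sum>m\<le>i + j. 1 / (fact m)\<^sup>2 * (if i = m \<and> j = m then 1 else 0))"
    by (simp add: I0_2sqrt_xy_def bsubst_def I0_core_def)
  also have "\<dots> = (\<Sum>m\<le>i + j. if m = i then (if i = j then 1 / (fact i)\<^sup>2 else 0) else 0)"
    by (rule sum.cong) auto
  finally show ?thesis by simp
qed

lemma exp_x_plus_y_nth: "exp_x_plus_y $ i $ j = 1 / (fact i * fact j)"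
proof -
  have c: "((bX + bY) ^ m) $ i $ j = (if m = i + j then real (m choose i) else 0)" for m
  proof -
    have "((bX + bY) ^ m) $ i $ j =
        (\<Sum>l\<le>m. (of_nat (m choose l) * bX ^ l * bY ^ (m - l)) $ i $ j)"
      by (simp add: binomial_ring fps_sum_nth)
    also have "\<dots> = (\<Sum>l\<le>m. if l = i then (if m - i = j then real (m choose i) else 0) else 0)"
      by (intro sum.cong refl)
         (auto simp: bX_def bY_def fps_const_power fps_X_power_nth mult.assoc
               simp flip: fps_of_nat)
    also have "\<dots> = (if m = i + j then real (m choose i) else 0)"
      by auto
    finally show ?thesis .
  qed
  have "exp_x_plus_y $ i $ j = real ((i + j) choose i) / fact (i + j)"
    unfolding exp_x_plus_y_def bsubst_def by (simp add: c if_distrib[of "\<lambda>x. x / _"] cong: if_cong)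
  then show ?thesis
    by (simp add: binomial_fact)
qed

text \<open>The term of index \<open>(r, n)\<close> is the one with monomial \<open>x\<^sup>r y\<^sup>s\<close>, where \<open>n = r + s\<close>.\<close>

definition Kgf :: bfps where
  "Kgf = Abs_fps (\<lambda>r. Abs_fps (\<lambda>s. real (kcount r (r + s)) / (fact r * fact s)))"

definition is_L :: "bfps \<Rightarrow> bool" where
  "is_L L \<longleftrightarrow> dx (dy L) = exp_x_plus_y * I0_2sqrt_xy \<and> at_y0 L = 0 \<and> at_x0 L = 0"

text \<open>
  Division of power series over a ring that is not a field is only meaningful for invertible
  denominators, as is the case for \<open>1 - x - y + xy\<close>.
\<close>

lemma denominator_times_inverse:
  "(1 - bX - bY + bX * bY) * inverse (1 - bX - bY + bX * bY) = 1"
proof -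
  have "(1 - fps_X :: real fps) * inverse (1 - fps_X) = 1"
    by (intro inverse_mult_eq_1') simp
  then show ?thesis
    unfolding fps_inverse_def by (intro fps_right_inverse) (simp add: bX_def bY_def)
qed

lemma divide_denominator:
  "F / (1 - bX - bY + bX * bY) = F * inverse (1 - bX - bY + bX * bY)"
proof -
  have "(1 - bX - bY + bX * bY) $ 0 \<noteq> 0"
    by (simp add: bX_def bY_def)
  then show ?thesis
    by (simp add: fps_divide_def)
qed

unbundle no fps_syntax

end

theory Submission
  imports Defs "HOL-Combinatorics.Multiset_Permutations"
begin

text \<open>
  Let \<open>A\<close> be the set of values that \<open>w\<close> takes on the first \<open>r\<close> positions and \<open>B\<close> the set of the
  remaining \<open>s = n - r\<close> values. Avoiding both patterns means that the \<open>p\<close> elements of \<open>A\<close> exceeding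
  \<open>Min B\<close> and the \<open>q\<close> elements of \<open>B\<close> below \<open>Max A\<close> appear in decreasing order, so \<open>A\<close> accounts for
  \<open>(r!/p!) (s!/q!)\<close> permutations. Write \<open>A\<close> as a word in the letters \<open>a, b\<close>: deleting the initial run
  of \<open>a\<close> and the final run of \<open>b\<close> leaves a word with \<open>p\<close> letters \<open>a\<close> and \<open>q\<close> letters \<open>b\<close> that is empty
  or starts with \<open>b\<close> and ends with \<open>a\<close>; there are \<open>(p + q - 2) choose (p - 1)\<close> such nonempty words.
  As the lengths of the two runs are determined by \<open>p\<close> and \<open>q\<close>, the coefficients of \<open>K\<close> are the double
  partial sums of these numbers divided by \<open>p! q!\<close>, which by Vandermonde are the coefficients of
  \<open>L + 1\<close>.
\<close>

section \<open>Orderings of a finite set with a prescribed order on a subset\<close>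

lemma sorted_wrt_filter_iff:
  "sorted_wrt R (filter P xs) \<longleftrightarrow> sorted_wrt (\<lambda>x y. P x \<longrightarrow> P y \<longrightarrow> R x y) xs"
  by (induction xs) auto

lemma sorted_wrt_upt_iff:
  "sorted_wrt R [a..<b] \<longleftrightarrow> (\<forall>i j. a \<le> i \<longrightarrow> i < j \<longrightarrow> j < b \<longrightarrow> R i j)"
proof (induction b)
  case (Suc b)
  show ?case
    by (auto simp: sorted_wrt_append Suc less_Suc_eq)
qed simp

text \<open>Such orderings are the shuffles of \<open>zs\<close> with an arbitrary ordering of the
  remaining elements: a factorial times a binomial coefficient. The product form avoids division of
  natural numbers.\<close>

lemma card_permutations_of_set_filter_eq:
  assumes "finite A" "set zs = {x\<in>A. P x}" "distinct zs"
  shows "card {xs \<in> permutations_of_set A. filter P xs = zs} * fact (length zs) = fact (card A)"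
proof -
  let ?N = "{x\<in>A. \<not> P x}"
  have fin: "finite ?N" "finite {x\<in>A. P x}"
    using assms by auto
  have len: "length zs = card {x\<in>A. P x}"
    using assms distinct_card by metis
  have A: "card A = length zs + card ?N"
    unfolding len using fin by (subst card_Un_disjoint [symmetric]) (auto intro: arg_cong[where f = card])
  have eq: "{xs \<in> permutations_of_set A. filter P xs = zs} =
      (\<Union>us\<in>permutations_of_set ?N. shuffles zs us)"
  proof (intro equalityI subsetI)
    fix xs assume xs: "xs \<in> {xs \<in> permutations_of_set A. filter P xs = zs}"
    then have "xs \<in> shuffles zs (filter (\<lambda>x. \<not> P x) xs)"
      using partition_in_shuffles[of xs P] by simp
    moreover have "filter (\<lambda>x. \<not> P x) xs \<in> permutations_of_set ?N"
      using xs by (auto simp: permutations_of_set_def)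
    ultimately show "xs \<in> (\<Union>us\<in>permutations_of_set ?N. shuffles zs us)"
      by blast
  next
    fix xs assume "xs \<in> (\<Union>us\<in>permutations_of_set ?N. shuffles zs us)"
    then obtain us where us: "set us = ?N" "distinct us" "xs \<in> shuffles zs us"
      by (auto simp: permutations_of_set_def)
    have "partition P -` {(zs, us)} = shuffles zs us"
      using us assms by (intro inv_image_partition) auto
    then have "filter P xs = zs"
      using us by auto
    moreover have "set xs = A"
      using set_shuffles[OF us(3)] us assms by auto
    moreover have "distinct xs"
      using distinct_disjoint_shuffles[of zs us xs] us assms by auto
    ultimately show "xs \<in> {xs \<in> permutations_of_set A. filter P xs = zs}"
      by (auto simp: permutations_of_set_def)
  qed
  \<comment> \<open>\<open>partition P\<close> recovers both shuffled lists, so different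
    \<open>us\<close> share no shuffle.\<close>
  have disj: "shuffles zs us \<inter> shuffles zs vs = {}"
    if "us \<in> permutations_of_set ?N" "vs \<in> permutations_of_set ?N" "us \<noteq> vs" for us vs
  proof -
    have "partition P -` {(zs, ws)} = shuffles zs ws" if "ws \<in> permutations_of_set ?N" for ws
      using that assms by (intro inv_image_partition) (auto simp: permutations_of_set_def)
    from this[OF that(1), symmetric] this[OF that(2), symmetric] that(3) show ?thesis
      by auto
  qed
  have "card {xs \<in> permutations_of_set A. filter P xs = zs} =
      (\<Sum>us\<in>permutations_of_set ?N. card (shuffles zs us))"
    unfolding eq by (rule card_UN_disjoint) (use disj in auto)
  also have "\<dots> = (\<Sum>us\<in>permutations_of_set ?N. card A choose length zs)"
  proof (rule sum.cong)
    fix us assume us: "us \<in> permutations_of_set ?N"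
    then have "length us = card ?N"
      using distinct_card[of us] by (simp add: permutations_of_set_def)
    then show "card (shuffles zs us) = card A choose length zs"
      using us assms A by (subst card_disjoint_shuffles) (auto simp: permutations_of_set_def)
  qed simp
  also have "\<dots> = fact (card ?N) * (card A choose length zs)"
    using fin by simp
  finally show ?thesis
    using binomial_fact_lemma[of "length zs" "card A"] A
    by (simp add: mult.commute mult.left_commute)
qed

text \<open>Exactly one listing of the selected elements is strictly decreasing, which reduces the
  count to that of a fixed \<open>zs\<close>.\<close>

lemma card_permutations_of_set_filter_decreasing:
  fixes A :: "'a::linorder set"
  assumes "finite A"
  shows "card {xs \<in> permutations_of_set A. sorted_wrt (>) (filter P xs)} * fact (card {x\<in>A. P x})
    = fact (card A)"
proof -
  define zs where "zs = rev (sorted_list_of_set {x\<in>A. P x})"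
  have fin: "finite {x\<in>A. P x}"
    using assms by simp
  have zs: "set zs = {x\<in>A. P x}" "distinct zs" "length zs = card {x\<in>A. P x}"
    using fin by (auto simp: zs_def)
  have "sorted_wrt (>) (filter P xs) \<longleftrightarrow> filter P xs = zs" if "xs \<in> permutations_of_set A" for xs
  proof
    assume "filter P xs = zs"
    then show "sorted_wrt (>) (filter P xs)"
      by (simp add: zs_def sorted_wrt_rev)
  next
    assume "sorted_wrt (>) (filter P xs)"
    then have "sorted_wrt (<) (rev (filter P xs))"
      by (simp add: sorted_wrt_rev)
    moreover have "set (rev (filter P xs)) = {x\<in>A. P x}"
      using that by (auto simp: permutations_of_set_def)
    ultimately have "rev (filter P xs) = sorted_list_of_set {x\<in>A. P x}"
      by (metis sorted_list_of_set.idem_if_sorted_distinct strict_sorted_iff)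
    then show "filter P xs = zs"
      by (simp add: zs_def rev_swap)
  qed
  then have "{xs \<in> permutations_of_set A. sorted_wrt (>) (filter P xs)} =
      {xs \<in> permutations_of_set A. filter P xs = zs}"
    by blast
  then show ?thesis
    using card_permutations_of_set_filter_eq[OF assms zs(1,2)] zs(3) by simp
qed

section \<open>Splitting a permutation at position \<open>r\<close>\<close>

definition upper :: "nat set \<Rightarrow> nat set \<Rightarrow> nat set" where
  "upper A B = {a\<in>A. \<exists>b\<in>B. b < a}"

definition lower :: "nat set \<Rightarrow> nat set \<Rightarrow> nat set" where
  "lower A B = {b\<in>B. \<exists>a\<in>A. b < a}"

text \<open>The possible words of the first \<open>r\<close> values of an avoiding permutation with
  left values \<open>A\<close> and right values \<open>B\<close>. The existential condition stands
  for \<open>Min B < a\<close> and covers an empty \<open>B\<close> without a special case.\<close>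

definition left_orders :: "nat set \<Rightarrow> nat set \<Rightarrow> nat list set" where
  "left_orders A B = {xs \<in> permutations_of_set A. sorted_wrt (>) (filter (\<lambda>a. \<exists>b\<in>B. b < a) xs)}"

definition right_orders :: "nat set \<Rightarrow> nat set \<Rightarrow> nat list set" where
  "right_orders A B = {ys \<in> permutations_of_set B. sorted_wrt (>) (filter (\<lambda>b. \<exists>a\<in>A. b < a) ys)}"

lemma card_left_orders:
  assumes "finite A"
  shows "card (left_orders A B) * fact (card (upper A B)) = fact (card A)"
  unfolding left_orders_def upper_def
  by (rule card_permutations_of_set_filter_decreasing[OF assms])

lemma card_right_orders:
  assumes "finite B"
  shows "card (right_orders A B) * fact (card (lower A B)) = fact (card B)"
  unfolding right_orders_def lower_def
  by (rule card_permutations_of_set_filter_decreasing[OF assms])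

text \<open>A left value exceeding the larger of two right values exceeds the smaller as well, so an
  ascent in the filtered list is precisely an occurrence of \<open>3|12\<close>. Injectivity turns
  the absence of ascents into strict descent.\<close>

lemma avoids_3_12_iff:
  assumes "inj w"
  shows "\<not> contains_3_12 r (r + s) w \<longleftrightarrow>
    sorted_wrt (>) (filter (\<lambda>b. \<exists>a\<in>w ` {1..r}. b < a) (map w [r+1..<r+s+1]))"
proof -
  have ne: "w i \<noteq> w j" if "i < j" for i j
    using assms that by (auto dest: injD)
  have "sorted_wrt (>) (filter (\<lambda>b. \<exists>a\<in>w ` {1..r}. b < a) (map w [r+1..<r+s+1])) \<longleftrightarrow>
    (\<forall>i j. r + 1 \<le> i \<longrightarrow> i < j \<longrightarrow> j < r + s + 1 \<longrightarrow>
      (\<exists>a\<in>{1..r}. w i < w a) \<longrightarrow> (\<exists>a\<in>{1..r}. w j < w a) \<longrightarrow> w i > w j)"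
    unfolding sorted_wrt_filter_iff sorted_wrt_map sorted_wrt_upt_iff by simp
  also have "\<dots> \<longleftrightarrow> (\<forall>i j. r + 1 \<le> i \<longrightarrow> i < j \<longrightarrow> j < r + s + 1 \<longrightarrow>
      \<not> (\<exists>a\<in>{1..r}. w i < w j \<and> w j < w a))"
    by (meson ne less_asym less_trans linorder_neqE_nat)
  also have "\<dots> \<longleftrightarrow> \<not> contains_3_12 r (r + s) w"
    unfolding contains_3_12_def by (simp add: Ball_def Bex_def) (auto 4 4 simp: less_Suc_eq_le Suc_le_eq)
  finally show ?thesis ..
qed

text \<open>The mirror image: a right value below the smaller of two left values is below the larger
  as well.\<close>

lemma avoids_23_1_iff:
  assumes "inj w"
  shows "\<not> contains_23_1 r (r + s) w \<longleftrightarrow>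
    sorted_wrt (>) (filter (\<lambda>a. \<exists>b\<in>w ` {r+1..r+s}. b < a) (map w [1..<r+1]))"
proof -
  have ne: "w i \<noteq> w j" if "i < j" for i j
    using assms that by (auto dest: injD)
  have "sorted_wrt (>) (filter (\<lambda>a. \<exists>b\<in>w ` {r+1..r+s}. b < a) (map w [1..<r+1])) \<longleftrightarrow>
    (\<forall>i j. 1 \<le> i \<longrightarrow> i < j \<longrightarrow> j < r + 1 \<longrightarrow>
      (\<exists>b\<in>{r+1..r+s}. w b < w i) \<longrightarrow> (\<exists>b\<in>{r+1..r+s}. w b < w j) \<longrightarrow> w i > w j)"
    unfolding sorted_wrt_filter_iff sorted_wrt_map sorted_wrt_upt_iff by simp
  also have "\<dots> \<longleftrightarrow> (\<forall>i j. 1 \<le> i \<longrightarrow> i < j \<longrightarrow> j < r + 1 \<longrightarrow>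
      \<not> (\<exists>b\<in>{r+1..r+s}. w b < w i \<and> w i < w j))"
    by (meson ne less_asym less_trans linorder_neqE_nat)
  also have "\<dots> \<longleftrightarrow> \<not> contains_23_1 r (r + s) w"
  proof -
    have "contains_23_1 r (r + s) w \<longleftrightarrow>
        (\<exists>i j. 1 \<le> i \<and> i < j \<and> j < r + 1 \<and> (\<exists>b\<in>{r+1..r+s}. w b < w i \<and> w i < w j))"
    proof
      assume "contains_23_1 r (r + s) w"
      then obtain i j b where "i \<in> {1..r+s}" "j \<in> {1..r+s}" "b \<in> {1..r+s}" "i < j" "j \<le> r" "r < b"
        "w b < w i" "w i < w j"
        unfolding contains_23_1_def by blast
      moreover from this have "1 \<le> i" "j < r + 1" "b \<in> {r+1..r+s}"
        by auto
      ultimately show "\<exists>i j. 1 \<le> i \<and> i < j \<and> j < r + 1 \<and> (\<exists>b\<in>{r+1..r+s}. w b < w i \<and> w i < w j)"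
        by blast
    next
      assume "\<exists>i j. 1 \<le> i \<and> i < j \<and> j < r + 1 \<and> (\<exists>b\<in>{r+1..r+s}. w b < w i \<and> w i < w j)"
      then obtain i j b where "1 \<le> i" "i < j" "j < r + 1" "b \<in> {r+1..r+s}" "w b < w i" "w i < w j"
        by blast
      moreover from this have "i \<in> {1..r+s}" "j \<in> {1..r+s}" "b \<in> {1..r+s}" "j \<le> r" "r < b"
        by auto
      ultimately show "contains_23_1 r (r + s) w"
        unfolding contains_23_1_def by blast
    qed
    then show ?thesis by blast
  qed
  finally show ?thesis ..
qed

text \<open>Cutting the one-line notation after position \<open>r\<close> is injective, and for a
  given set \<open>A\<close> of left values the conditions on the two pieces are independent, hence
  the product.\<close>

lemma kcount_eq_sum_left_sets:
  "kcount r (r + s) = (\<Sum>A | A \<subseteq> {1..r+s} \<and> card A = r.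
     card (left_orders A ({1..r+s} - A)) * card (right_orders A ({1..r+s} - A)))"
proof -
  let ?n = "r + s"
  let ?S = "{w. w permutes {1..?n} \<and> \<not> contains_3_12 r ?n w \<and> \<not> contains_23_1 r ?n w}"
  let ?\<A> = "{A. A \<subseteq> {1..?n} \<and> card A = r}"
  let ?T = "\<lambda>A. left_orders A ({1..?n} - A) \<times> right_orders A ({1..?n} - A)"
  let ?\<phi> = "\<lambda>w::nat \<Rightarrow> nat. (map w [1..<r+1], map w [r+1..<?n+1])"
  have split: "{1..?n} = {1..r} \<union> {r+1..?n}" "{1..r} \<inter> {r+1..?n} = {}"
    by auto
  have inj: "inj_on ?\<phi> ?S"
  proof (rule inj_onI)
    fix v w assume v: "v \<in> ?S" and w: "w \<in> ?S" and eq: "?\<phi> v = ?\<phi> w"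
    show "v = w"
    proof
      fix i
      have "v i = w i" if "i \<in> {1..?n}"
        using eq that by (cases "i \<le> r") (auto simp: less_Suc_eq_le simp del: upt_Suc)
      moreover have "v i = w i" if "i \<notin> {1..?n}"
        using v w that by (auto simp: permutes_def)
      ultimately show "v i = w i" by blast
    qed
  qed
  \<comment> \<open>The avoidance criteria speak of images of positions, the order sets of
    \<open>A\<close> and its complement; this equation links the two.\<close>
  have compl: "w ` {r+1..?n} = {1..?n} - w ` {1..r}" if "w permutes {1..?n}" for w
  proof -
    have "w ` {1..?n} = {1..?n}" "inj w"
      using that by (auto simp: permutes_image permutes_inj)
    moreover have "{r+1..?n} = {1..?n} - {1..r}" by auto
    ultimately show ?thesis
      by (metis image_set_diff)
  qed
  have good: "w \<in> ?S \<longleftrightarrow> ?\<phi> w \<in> ?T (w ` {1..r})" if "w permutes {1..?n}" for w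
  proof -
    have i: "inj w" using that by (rule permutes_inj)
    have s1: "set [1..<r+1] = {1..r}" and s2: "set [r+1..<?n+1] = {r+1..?n}"
      by auto
    have "map w [1..<r+1] \<in> permutations_of_set (w ` {1..r})"
      unfolding permutations_of_set_def mem_Collect_eq set_map s1 distinct_map
      using i by (auto intro: inj_on_subset)
    moreover have "map w [r+1..<?n+1] \<in> permutations_of_set (w ` {r+1..?n})"
      unfolding permutations_of_set_def mem_Collect_eq set_map s2 distinct_map
      using i by (auto intro: inj_on_subset)
    ultimately show ?thesis
      using that
      unfolding mem_Collect_eq avoids_3_12_iff[OF i] avoids_23_1_iff[OF i] left_orders_def
        right_orders_def compl[OF that, symmetric] mem_Times_iff fst_conv snd_conv by blast
  qed
  have image: "?\<phi> ` ?S = (\<Union>A\<in>?\<A>. ?T A)"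
  proof (intro equalityI subsetI)
    fix z assume "z \<in> ?\<phi> ` ?S"
    then obtain w where w: "w \<in> ?S" "z = ?\<phi> w" by blast
    then have p: "w permutes {1..?n}" by simp
    have "w ` {1..r} \<subseteq> {1..?n}"
      using permutes_image[OF p] split(1) by blast
    moreover have "card (w ` {1..r}) = r"
      using permutes_inj[OF p] by (simp add: card_image inj_on_subset)
    ultimately show "z \<in> (\<Union>A\<in>?\<A>. ?T A)"
      using good[OF p] w by blast
  next
    fix z assume "z \<in> (\<Union>A\<in>?\<A>. ?T A)"
    then obtain A xs ys where A: "A \<subseteq> {1..?n}" "card A = r" and z: "z = (xs, ys)" "z \<in> ?T A"
      by blast
    have xs: "set xs = A" "distinct xs" and ys: "set ys = {1..?n} - A" "distinct ys"
      using z by (auto simp: left_orders_def right_orders_def permutations_of_set_def)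
    have fA: "finite A" using A finite_subset by blast
    have lx: "length xs = r"
      using xs A distinct_card by metis
    have ly: "length ys = s"
      using ys A fA distinct_card[of ys] by (simp add: card_Diff_subset)
    \<comment> \<open>Positions start at 1 and list indices at 0; outside \<open>{1..?n}\<close> the
      identity is what \<open>permutes\<close> demands.\<close>
    define w where "w = (\<lambda>i. if i \<in> {1..?n} then (xs @ ys) ! (i - 1) else i)"
    have w1: "map w [1..<r+1] = xs"
      by (rule nth_equalityI) (auto simp: w_def lx nth_append simp del: upt_Suc)
    have w2: "map w [r+1..<?n+1] = ys"
      by (rule nth_equalityI) (auto simp: w_def lx ly nth_append simp del: upt_Suc)
    have s1: "set [1..<r+1] = {1..r}" and s2: "set [r+1..<?n+1] = {r+1..?n}"
      by auto
    have i1: "w ` {1..r} = A"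
      using xs(1) w1 by (metis s1 set_map)
    have i2: "w ` {r+1..?n} = {1..?n} - A"
      using ys(1) w2 by (metis s2 set_map)
    have im: "w ` {1..?n} = {1..?n}"
      unfolding split(1) image_Un i1 i2 using A split(1) by auto
    then have "inj_on w {1..?n}"
      by (intro eq_card_imp_inj_on) auto
    then have p: "w permutes {1..?n}"
      using im by (intro bij_imp_permutes) (auto simp: bij_betw_def w_def)
    have \<phi>: "z = ?\<phi> w"
      by (simp only: w1 w2 z(1))
    have "w \<in> ?S"
      unfolding good[OF p] i1 \<phi>[symmetric] by (rule z(2))
    with \<phi> show "z \<in> ?\<phi> ` ?S"
      by (rule image_eqI)
  qed
  have "kcount r ?n = card (?\<phi> ` ?S)"
    unfolding kcount_def using inj by (simp add: card_image)
  also have "\<dots> = (\<Sum>A\<in>?\<A>. card (?T A))"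
    unfolding image
  proof (rule card_UN_disjoint)
    show "\<forall>A\<in>?\<A>. finite (?T A)"
      by (simp add: left_orders_def right_orders_def)
    \<comment> \<open>The entries of the first list determine \<open>A\<close>.\<close>
    show "\<forall>A\<in>?\<A>. \<forall>B\<in>?\<A>. A \<noteq> B \<longrightarrow> ?T A \<inter> ?T B = {}"
      by (auto simp: left_orders_def permutations_of_set_def)
  qed simp
  finally show ?thesis
    by (simp add: card_cartesian_product)
qed

text \<open>The factorials of \<open>r\<close> and \<open>s\<close> are the numerators in the counts
  of left and right orders, so the normalisation in \<open>Kgf\<close> leaves only the sizes of
  \<open>upper\<close> and \<open>lower\<close>, the profile of \<open>A\<close>.\<close>

lemma kcount_over_fact:
  "real (kcount r (r + s)) / (fact r * fact s) = (\<Sum>A | A \<subseteq> {1..r+s} \<and> card A = r.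
     1 / (fact (card (upper A ({1..r+s} - A))) * fact (card (lower A ({1..r+s} - A)))))"
  unfolding kcount_eq_sum_left_sets of_nat_sum sum_divide_distrib
proof (rule sum.cong)
  fix A assume A: "A \<in> {A. A \<subseteq> {1..r+s} \<and> card A = r}"
  let ?B = "{1..r+s} - A"
  have fA: "finite A" using A finite_subset by blast
  have cB: "card ?B = s" using A fA by (simp add: card_Diff_subset)
  have "real (card (left_orders A ?B)) * fact (card (upper A ?B)) = fact r"
    using card_left_orders[OF fA, of ?B] A by (metis (mono_tags) mem_Collect_eq of_nat_fact of_nat_mult)
  moreover have "real (card (right_orders A ?B)) * fact (card (lower A ?B)) = fact s"
    using card_right_orders[of ?B A] cB by (metis finite_Diff finite_atLeastAtMost of_nat_fact of_nat_mult)
  ultimately have "real (card (left_orders A ?B)) = fact r / fact (card (upper A ?B))"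
    "real (card (right_orders A ?B)) = fact s / fact (card (lower A ?B))"
    by (simp_all add: eq_divide_eq)
  then show "real (card (left_orders A ?B) * card (right_orders A ?B)) / (fact r * fact s) =
      1 / (fact (card (upper A ?B)) * fact (card (lower A ?B)))"
    by simp
qed simp

section \<open>Sets of left values with a given profile\<close>

text \<open>The number of words with \<open>p\<close> letters \<open>a\<close> and \<open>q\<close> letters \<open>b\<close> that are empty or start with \<open>b\<close>
  and end with \<open>a\<close>.\<close>

definition middle_words :: "nat \<Rightarrow> nat \<Rightarrow> nat" where
  "middle_words p q =
    (if p = 0 \<and> q = 0 then 1 else if p = 0 \<or> q = 0 then 0 else (p + q - 2) choose (p - 1))"

text \<open>If no right value lies below a left value, every positive number below an element of
  \<open>A\<close> is in \<open>A\<close>, so \<open>A\<close> is an initial segment.\<close>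

lemma left_set_trivial_profile:
  assumes "A \<subseteq> {1..r+s}" "card A = r"
  shows "upper A ({1..r+s} - A) = {} \<longleftrightarrow> A = {1..r}"
proof
  assume e: "upper A ({1..r+s} - A) = {}"
  have fA: "finite A" using assms finite_subset by blast
  show "A = {1..r}"
  proof (cases "A = {}")
    case False
    let ?m = "Max A"
    have m: "?m \<in> A" using fA False by simp
    \<comment> \<open>A number below \<open>?m\<close> missing from \<open>A\<close> would put
      \<open>?m\<close> into \<open>upper\<close>.\<close>
    have "A = {1..?m}"
    proof (intro equalityI subsetI)
      fix x assume "x \<in> {1..?m}"
      then show "x \<in> A"
        using e m subsetD[OF assms(1) m] unfolding upper_def
        by (cases "x = ?m") (auto dest!: spec[of _ ?m] bspec[of _ _ x])
    qed (use assms fA in auto)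
    then show ?thesis using assms by (metis card_atLeastAtMost diff_Suc_1)
  qed (use assms in auto)
qed (auto simp: upper_def)

text \<open>The element missing between \<open>r - p\<close> and \<open>r - p + 2\<close> is \<open>Min B\<close>, and \<open>r + q\<close> is \<open>Max A\<close>.\<close>

lemma left_sets_with_profile:
  assumes "1 \<le> p" "1 \<le> q" "p \<le> r" "q \<le> s"
  shows "{A. A \<subseteq> {1..r+s} \<and> card A = r \<and> card (upper A ({1..r+s} - A)) = p \<and>
              card (lower A ({1..r+s} - A)) = q} =
    (\<lambda>C. {1..r-p} \<union> {r+q} \<union> C) ` {C. C \<subseteq> {r-p+2..<r+q} \<and> card C = p - 1}"
    (is "?L = ?f ` ?R")
proof (intro equalityI subsetI)
  fix A assume "A \<in> ?L"
  let ?B = "{1..r+s} - A"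
  from \<open>A \<in> ?L\<close> have A: "A \<subseteq> {1..r+s}" "card A = r" "card (upper A ?B) = p" "card (lower A ?B) = q"
    by auto
  have fA: "finite A" using A finite_subset by blast
  have "A \<noteq> {}" "?B \<noteq> {}"
    using A assms by (auto simp: upper_def)
  define a where "a = Max A"
  define b where "b = Min ?B"
  have a: "a \<in> A" "\<And>x. x \<in> A \<Longrightarrow> x \<le> a"
    using fA \<open>A \<noteq> {}\<close> by (auto simp: a_def)
  have b: "b \<in> ?B" "\<And>x. x \<in> ?B \<Longrightarrow> b \<le> x"
    using Min_in[of ?B] \<open>?B \<noteq> {}\<close> by (auto simp: b_def simp del: Diff_iff)
  have u: "upper A ?B = {x\<in>A. b < x}"
    using b by (force simp: upper_def)
  \<comment> \<open>All positive numbers below \<open>b = Min ?B\<close> lie in \<open>A\<close>;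
    counting \<open>A\<close> along this decomposition gives the value of \<open>b\<close>.\<close>
  have "A = upper A ?B \<union> {1..<b}"
  proof (intro equalityI subsetI)
    fix x assume "x \<in> A"
    then show "x \<in> upper A ?B \<union> {1..<b}"
      using b(1) A unfolding u by (cases "x = b") auto
  next
    fix x assume "x \<in> upper A ?B \<union> {1..<b}"
    then show "x \<in> A"
      using b(1) b(2)[of x] unfolding u by (cases "x \<in> A") auto
  qed
  moreover have "card (upper A ?B \<union> {1..<b}) = p + (b - 1)"
    using A(3) fA unfolding u by (subst card_Un_disjoint) auto
  ultimately have "r = p + (b - 1)" using A by metis
  then have b_eq: "b = r - p + 1" using b(1) assms by auto
  have l: "lower A ?B = {x\<in>?B. x < a}"
    using a by (force simp: lower_def)
  \<comment> \<open>Dually, every number up to \<open>a = Max A\<close> lies in \<open>A\<close> or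
    in \<open>lower\<close>; counting gives the value of \<open>a\<close>.\<close>
  have "{1..a} = A \<union> lower A ?B"
  proof (intro equalityI subsetI)
    fix x assume "x \<in> {1..a}"
    then show "x \<in> A \<union> lower A ?B"
      using a(1) subsetD[OF A(1) a(1)] unfolding l by (cases "x = a") auto
  next
    fix x assume "x \<in> A \<union> lower A ?B"
    then show "x \<in> {1..a}"
      using a(2) A(1) unfolding l by auto
  qed
  moreover have "card (A \<union> lower A ?B) = r + q"
    using A(2,4) fA unfolding l by (subst card_Un_disjoint) auto
  ultimately have a_eq: "a = r + q" by (metis card_atLeastAtMost diff_Suc_1)
  \<comment> \<open>With \<open>Min ?B\<close> and \<open>Max A\<close> forced, only the numbers
    strictly between them are free.\<close>
  define C where "C = A \<inter> {r-p+2..<r+q}"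
  have AC: "A = ?f C"
  proof (intro equalityI subsetI)
    fix x assume x: "x \<in> A"
    then have "x \<le> r + q" "x \<noteq> r - p + 1" "1 \<le> x"
      using a a_eq b b_eq A by auto
    then show "x \<in> ?f C"
      using x by (auto simp: C_def)
  next
    fix x assume "x \<in> ?f C"
    moreover have "x \<in> A" if "x \<in> {1..r-p}"
    proof -
      have "x \<in> {1..r+s}" "\<not> b \<le> x"
        using that b_eq by auto
      then show ?thesis using b(2)[of x] by blast
    qed
    ultimately show "x \<in> A" using a a_eq by (auto simp: C_def)
  qed
  have "card (?f C) = r - p + 1 + card C"
    using assms by (subst card_Un_disjoint; (subst card_Un_disjoint)?) (auto simp: C_def)
  then have "card C = p - 1"
    using A(2) AC assms by simp
  then have "C \<in> ?R"
    by (simp add: C_def)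
  with AC show "A \<in> ?f ` ?R"
    by (rule image_eqI)
next
  fix A assume "A \<in> ?f ` ?R"
  then obtain C where C: "C \<subseteq> {r-p+2..<r+q}" "card C = p - 1" and A: "A = ?f C"
    by blast
  let ?B = "{1..r+s} - A"
  have fC: "finite C" using C finite_subset by blast
  have 1: "A \<subseteq> {1..r+s}" using A C assms by auto
  have 2: "card A = r"
    unfolding A using assms C fC by (subst card_Un_disjoint; (subst card_Un_disjoint)?) auto
  \<comment> \<open>This gap after the initial run is the smallest element of \<open>?B\<close>; it
    puts every element of \<open>{r+q} \<union> C\<close> into \<open>upper\<close>.\<close>
  have b: "r - p + 1 \<in> ?B" using A C assms by auto
  have u: "upper A ?B = {r+q} \<union> C"
  proof (intro equalityI subsetI)
    fix x assume "x \<in> {r+q} \<union> C"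
    then have "x \<in> A" "r - p + 1 < x" using A C assms by auto
    then show "x \<in> upper A ?B" using b by (auto simp: upper_def)
  next
    fix x assume "x \<in> upper A ?B"
    then obtain y where "x \<in> A" "y \<in> ?B" "y < x" by (auto simp: upper_def)
    then show "x \<in> {r+q} \<union> C" using A by auto
  qed
  have 3: "card (upper A ?B) = p"
    unfolding u using C fC assms by (subst card_Un_disjoint) auto
  have l: "lower A ?B = {r-p+1..r+q} - ({r+q} \<union> C)"
  proof (intro equalityI subsetI)
    fix x assume x: "x \<in> {r-p+1..r+q} - ({r+q} \<union> C)"
    then have "x \<in> ?B" "x < r + q" using A assms by auto
    then show "x \<in> lower A ?B" using A by (auto simp: lower_def)
  next
    fix x assume "x \<in> lower A ?B"
    then obtain y where "x \<in> ?B" "y \<in> A" "x < y" by (auto simp: lower_def)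
    then show "x \<in> {r-p+1..r+q} - ({r+q} \<union> C)" using A C by auto
  qed
  have "card (lower A ?B) = (p + q) - card ({r+q} \<union> C)"
    unfolding l using assms C fC by (subst card_Diff_subset) auto
  then have 4: "card (lower A ?B) = q"
    using 3 u by simp
  show "A \<in> ?L" using 1 2 3 4 by simp
qed

text \<open>For positive \<open>p\<close> and \<open>q\<close>, the free window between
  \<open>Min B\<close> and \<open>Max A\<close> has \<open>p + q - 2\<close> elements, of which
  \<open>p - 1\<close> belong to \<open>A\<close>. Hence the count does not depend on
  \<open>r\<close> and \<open>s\<close>.\<close>

lemma card_left_sets_with_profile:
  assumes "p \<le> r" "q \<le> s"
  shows "card {A. A \<subseteq> {1..r+s} \<and> card A = r \<and> card (upper A ({1..r+s} - A)) = p \<and>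
              card (lower A ({1..r+s} - A)) = q} = middle_words p q"
    (is "card ?L = _")
proof -
  \<comment> \<open>Each side says that no element of \<open>B\<close> lies below an element of
    \<open>A\<close>; a profile with exactly one zero is therefore impossible.\<close>
  have ul: "upper A B = {} \<longleftrightarrow> lower A B = {}" for A B
    by (auto simp: upper_def lower_def)
  have fin: "finite (upper A ({1..r+s} - A))" "finite (lower A ({1..r+s} - A))"
    if "A \<subseteq> {1..r+s}" for A
    using that finite_subset[of A] by (auto simp: upper_def lower_def)
  have zero: "card (upper A ({1..r+s} - A)) = 0 \<longleftrightarrow> card (lower A ({1..r+s} - A)) = 0"
    if "A \<subseteq> {1..r+s}" for A
    using fin[OF that] ul by simp
  consider "p = 0" "q = 0" | "(p = 0) \<noteq> (q = 0)" | "p > 0" "q > 0"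
    by auto
  then show ?thesis
  proof cases
    case 1
    have "?L = {{1..r}}"
    proof (intro equalityI subsetI)
      fix A assume "A \<in> ?L"
      then show "A \<in> {{1..r}}"
        using left_set_trivial_profile[of A r s] fin(1)[of A] 1 by simp
    next
      fix A assume "A \<in> {{1..r}}"
      moreover from this have "A \<subseteq> {1..r+s}" "card A = r"
        by auto
      ultimately show "A \<in> ?L"
        using left_set_trivial_profile[of A r s] zero[of A] 1 by simp
    qed
    then have "card ?L = 1"
      by (simp only: is_singletonI is_singleton_altdef [symmetric])
    then show ?thesis using 1 by (simp add: middle_words_def)
  next
    case 2
    have "?L = {}"
    proof (rule equals0I)
      fix A assume "A \<in> ?L"
      then have A: "A \<subseteq> {1..r+s}" "card (upper A ({1..r+s} - A)) = p"
        "card (lower A ({1..r+s} - A)) = q"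
        by simp_all
      show False
        using zero[OF A(1)] 2 unfolding A(2,3) by simp
    qed
    then have "card ?L = 0"
      by (simp only: card.empty)
    also have "0 = middle_words p q"
      using 2 by (auto simp: middle_words_def)
    finally show ?thesis .
  next
    case 3
    let ?R = "{C. C \<subseteq> {r-p+2..<r+q} \<and> card C = p - 1}"
    have "inj_on (\<lambda>C. {1..r-p} \<union> {r+q} \<union> C) ?R"
    proof (rule inj_onI)
      fix C D assume "C \<in> ?R" "D \<in> ?R" and eq: "{1..r-p} \<union> {r+q} \<union> C = {1..r-p} \<union> {r+q} \<union> D"
      \<comment> \<open>Intersecting with the window removes the initial run and \<open>r+q\<close>,
        which recovers \<open>C\<close>.\<close>
      from this(1,2) have "({1..r-p} \<union> {r+q} \<union> C) \<inter> {r-p+2..<r+q} = C"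
        "({1..r-p} \<union> {r+q} \<union> D) \<inter> {r-p+2..<r+q} = D" by auto
      then show "C = D" unfolding eq by simp
    qed
    then have "card ?L = card ?R"
      using left_sets_with_profile[of p q r s] 3 assms by (simp add: card_image)
    also have "\<dots> = (r + q - (r - p + 2)) choose (p - 1)"
      by (subst n_subsets) auto
    also have "r + q - (r - p + 2) = p + q - 2"
      using assms by simp
    finally have "card ?L = (p + q - 2) choose (p - 1)" .
    then show ?thesis
      using 3 by (simp only: middle_words_def) simp
  qed
qed

text \<open>The sets \<open>A\<close> are grouped by profile. As \<open>r\<close> and
  \<open>s\<close> only bound the range of profiles and do not affect the size of a group, a double
  partial sum results.\<close>

lemma kcount_over_fact_eq_double_sum:
  "real (kcount r (r + s)) / (fact r * fact s) =
    (\<Sum>p\<le>r. \<Sum>q\<le>s. real (middle_words p q) / (fact p * fact q))"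
proof -
  let ?\<A> = "{A. A \<subseteq> {1..r+s} \<and> card A = r}"
  let ?u = "\<lambda>A. card (upper A ({1..r+s} - A))" and ?l = "\<lambda>A. card (lower A ({1..r+s} - A))"
  have bound: "?u A \<le> r" "?l A \<le> s" if "A \<in> ?\<A>" for A
  proof -
    have fA: "finite A" using that finite_subset by blast
    then have "?u A \<le> card A" by (intro card_mono) (auto simp: upper_def)
    then show "?u A \<le> r" using that by simp
    have "?l A \<le> card ({1..r+s} - A)" by (intro card_mono) (auto simp: lower_def)
    then show "?l A \<le> s" using that fA by (simp add: card_Diff_subset)
  qed
  have fibre: "(\<Sum>A | A \<in> ?\<A> \<and> (?u A, ?l A) = (p, q). 1 / (fact (?u A) * fact (?l A) :: real)) =
      real (middle_words p q) / (fact p * fact q)" if "p \<le> r" "q \<le> s" for p q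
  proof -
    have "(\<Sum>A | A \<in> ?\<A> \<and> (?u A, ?l A) = (p, q). 1 / (fact (?u A) * fact (?l A) :: real)) =
      (\<Sum>A | A \<in> ?\<A> \<and> (?u A, ?l A) = (p, q). 1 / (fact p * fact q))"
      by (rule sum.cong) auto
    also have "\<dots> = real (card {A. A \<in> ?\<A> \<and> (?u A, ?l A) = (p, q)}) / (fact p * fact q)"
      by simp
    also have "card {A. A \<in> ?\<A> \<and> (?u A, ?l A) = (p, q)} = middle_words p q"
      using card_left_sets_with_profile[OF that] by (simp add: conj_assoc)
    finally show ?thesis .
  qed
  have "real (kcount r (r + s)) / (fact r * fact s) = (\<Sum>A\<in>?\<A>. 1 / (fact (?u A) * fact (?l A)))"
    by (rule kcount_over_fact)
  also have "\<dots> = (\<Sum>z\<in>{..r} \<times> {..s}. \<Sum>A | A \<in> ?\<A> \<and> (?u A, ?l A) = z. 1 / (fact (?u A) * fact (?l A)))"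
    by (rule sum.group [symmetric]) (use bound in auto)
  also have "\<dots> = (\<Sum>(p, q)\<in>{..r} \<times> {..s}. real (middle_words p q) / (fact p * fact q))"
  proof (rule sum.cong)
    fix z assume "z \<in> {..r} \<times> {..s}"
    then obtain p q where z: "z = (p, q)" "p \<le> r" "q \<le> s" by auto
    show "(\<Sum>A | A \<in> ?\<A> \<and> (?u A, ?l A) = z. 1 / (fact (?u A) * fact (?l A) :: real)) =
        (case z of (p, q) \<Rightarrow> real (middle_words p q) / (fact p * fact q))"
      unfolding z(1) prod.case by (rule fibre[OF z(2,3)])
  qed simp
  finally show ?thesis
    by (simp add: sum.cartesian_product)
qed

section \<open>Coefficients of the generating functions\<close>

unbundle fps_syntax

lemma exp_times_I0_nth:
  "(exp_x_plus_y * I0_2sqrt_xy) $ i $ j = real ((i + j) choose i) / (fact i * fact j)"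
proof -
  have "(exp_x_plus_y * I0_2sqrt_xy) $ i $ j =
      (\<Sum>a\<le>i. \<Sum>b\<le>j. 1 / (fact (i - a) * fact (j - b)) * (if a = b then 1 / (fact a)\<^sup>2 else 0))"
    \<comment> \<open>After the swap, \<open>a\<close> and \<open>b\<close> index the Bessel factor,
      which vanishes off the diagonal.\<close>
    by (subst mult.commute)
      (simp add: fps_mult_nth fps_sum_nth exp_x_plus_y_nth I0_2sqrt_xy_nth atLeast0AtMost mult.commute)
  \<comment> \<open>For \<open>a > j\<close> there is no diagonal term, matched by
    \<open>j choose a = 0\<close>; the form \<open>i choose (i - a)\<close> prepares for
    Vandermonde.\<close>
  also have "\<dots> = (\<Sum>a\<le>i. real ((i choose (i - a)) * (j choose a)) / (fact i * fact j))"
  proof (rule sum.cong)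
    fix a assume a: "a \<in> {..i}"
    have "(\<Sum>b\<le>j. 1 / (fact (i - a) * fact (j - b)) * (if a = b then 1 / (fact a)\<^sup>2 else 0)) =
      (if a \<le> j then 1 / (fact (i - a) * fact (j - a) * (fact a)\<^sup>2) else (0::real))"
      by (simp add: if_distrib cong: if_cong)
    also have "\<dots> = real ((i choose (i - a)) * (j choose a)) / (fact i * fact j)"
      using a by (auto simp: binomial_fact binomial_eq_0 power2_eq_square)
    finally show "(\<Sum>b\<le>j. 1 / (fact (i - a) * fact (j - b)) * (if a = b then 1 / (fact a)\<^sup>2 else 0)) =
      real ((i choose (i - a)) * (j choose a)) / (fact i * fact j)" .
  qed simp
  also have "\<dots> = real (\<Sum>a\<le>i. (j choose a) * (i choose (i - a))) / (fact i * fact j)"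
    by (simp add: sum_divide_distrib mult.commute)
  finally show ?thesis
    unfolding vandermonde by (simp add: add.commute)
qed

text \<open>The differential equation fixes the coefficients with both indices positive, the
  boundary conditions fix the others, and the added 1 accounts for the empty middle word.\<close>

lemma is_L_iff:
  "is_L L \<longleftrightarrow> L + 1 = Abs_fps (\<lambda>p. Abs_fps (\<lambda>q. real (middle_words p q) / (fact p * fact q)))"
    (is "_ \<longleftrightarrow> _ = ?M")
proof -
  have pde: "dx (dy L) $ i $ j = real (i + 1) * real (j + 1) * L $ (i + 1) $ (j + 1)" for i j
    by (simp add: dx_def dy_def fps_of_nat [symmetric])
  \<comment> \<open>The derivative factors extend the factorials to \<open>Suc i\<close> and
    \<open>Suc j\<close>, and \<open>(i + j) choose i\<close> is the middle word count
    there.\<close>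
  have step: "real (i + 1) * real (j + 1) * L $ (i + 1) $ (j + 1) = real ((i + j) choose i) / (fact i * fact j)
      \<longleftrightarrow> L $ Suc i $ Suc j = real (middle_words (Suc i) (Suc j)) / (fact (Suc i) * fact (Suc j))" for i j
    by (simp add: middle_words_def field_simps del: of_nat_Suc)
  have "is_L L \<longleftrightarrow> (\<forall>i j. L $ Suc i $ Suc j = real (middle_words (Suc i) (Suc j)) / (fact (Suc i) * fact (Suc j)))
      \<and> (\<forall>i. L $ i $ 0 = 0) \<and> (\<forall>j. L $ 0 $ j = 0)"
    unfolding is_L_def fps_eq_iff[of "dx _"] fps_eq_iff[of "_ $ _"] pde exp_times_I0_nth step
    by (auto simp: at_x0_def at_y0_def fps_eq_iff)
  also have "\<dots> \<longleftrightarrow> (\<forall>i j. (L + 1) $ i $ j = ?M $ i $ j)"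
  proof (intro iffI allI conjI)
    fix i j
    assume h: "(\<forall>i j. L $ Suc i $ Suc j = real (middle_words (Suc i) (Suc j)) / (fact (Suc i) * fact (Suc j)))
      \<and> (\<forall>i. L $ i $ 0 = 0) \<and> (\<forall>j. L $ 0 $ j = 0)"
    then show "(L + 1) $ i $ j = ?M $ i $ j"
      by (cases i; cases j) (simp_all add: middle_words_def)
  next
    assume h: "\<forall>i j. (L + 1) $ i $ j = ?M $ i $ j"
    fix i j
    show "L $ Suc i $ Suc j = real (middle_words (Suc i) (Suc j)) / (fact (Suc i) * fact (Suc j))"
      using h[rule_format, of "Suc i" "Suc j"] by simp
    show "L $ i $ 0 = 0" using h[rule_format, of i 0] by (cases i) (simp_all add: middle_words_def)
    show "L $ 0 $ j = 0" using h[rule_format, of 0 j] by (cases j) (simp_all add: middle_words_def)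
  qed
  finally show ?thesis by (simp add: fps_eq_iff)
qed

text \<open>The denominator factors as \<open>(1 - bX) * (1 - bY)\<close>, and each factor undoes
  the partial sums in its own variable.\<close>

lemma double_partial_sums_times_denominator:
  fixes M :: bfps
  shows "Abs_fps (\<lambda>r. Abs_fps (\<lambda>s. \<Sum>p\<le>r. \<Sum>q\<le>s. M $ p $ q)) * (1 - bX - bY + bX * bY) = M"
    (is "?S * _ = _")
proof -
  have "?S * (1 - bX - bY + bX * bY) = (1 - bX) * ((1 - bY) * ?S)"
    by (simp add: algebra_simps)
  also have "(1 - bY) * ?S = Abs_fps (\<lambda>r. \<Sum>p\<le>r. M $ p)"
  proof (intro fps_ext)
    fix i j
    show "((1 - bY) * ?S) $ i $ j = Abs_fps (\<lambda>r. \<Sum>p\<le>r. M $ p) $ i $ j"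
      by (cases j) (simp_all add: bY_def left_diff_distrib fps_sum_nth sum.distrib)
  qed
  also have "(1 - bX) * \<dots> = M"
  proof (rule fps_ext)
    fix i
    show "((1 - bX) * Abs_fps (\<lambda>r. \<Sum>p\<le>r. M $ p)) $ i = M $ i"
      by (cases i) (simp_all add: bX_def left_diff_distrib)
  qed
  finally show ?thesis .
qed

theorem theorem1p3:
  shows "(\<exists>!L. is_L L) \<and> (\<forall>L. is_L L \<longrightarrow> Kgf = (L + 1) / (1 - bX - bY + bX * bY))"
proof -
  let ?D = "1 - bX - bY + bX * bY"
  let ?M = "Abs_fps (\<lambda>p. Abs_fps (\<lambda>q. real (middle_words p q) / (fact p * fact q)))"
  have "Kgf * ?D = ?M"
    using double_partial_sums_times_denominator[of ?M]
    by (simp add: Kgf_def kcount_over_fact_eq_double_sum)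
  \<comment> \<open>Rewriting \<open>?M\<close> back to \<open>Kgf * ?D\<close> lets the denominator
    cancel against its inverse.\<close>
  then have K: "Kgf = ?M / ?D"
    by (simp add: divide_denominator mult.assoc denominator_times_inverse flip: \<open>Kgf * ?D = ?M\<close>)
  \<comment> \<open>An explicit solution formula gives existence and uniqueness at once.\<close>
  have "is_L L \<longleftrightarrow> L = ?M - 1" for L
    unfolding is_L_iff by (simp add: eq_diff_eq)
  then show ?thesis
    using K by auto
qed

unbundle no fps_syntax

end
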